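(* There is an absolute constant $C>0$ such that for all integers $n\ge 2$, $m\ge 1$ and every system $\mathcal{F}=\{F_1,\ldots,F_m\}$ of $m$ subsets of $[n]$, $$\operatorname{herdisc}(\mathcal{F})\le C\,\log(mn)\,\sqrt{\log n}\;\cdot\operatorname{detlb}(\mathcal{F}).$$
   Context: Let $[n]=\{1,\ldots,n\}$ be the vertex set and $\mathcal{F}=\{F_1,\ldots,F_m\}$ a system of subsets of $[n]$; here $n$ is the size of the ground set and $m=|\mathcal{F}|$. The discrepancy of a set system on a finite ground set $V$ is $\operatorname{disc}(\mathcal{F})=\min_{\chi}\max_{F\in\mathcal{F}}\bigl|\sum_{j\in F}\chi(j)\bigr|$, where the minimum is over all colorings $\chi:V\to\{-1,+1\}$. For $J\subseteq V$, the restriction is $\mathcal{F}|_J=\{F\cap J: F\in\mathcal{F}\}$, a set system on ground set $J$. The hereditary discrepancy is $\operatorname{herdisc}(\mathcal{F})=\max_{J\subseteq V}\operatorname{disc}(\mathcal{F}|_J)$. For a real matrix $A$, $\operatorname{detlb}(A)=\max_{k}\max_{B}|\det B|^{1/k}$, where $k\ge 1$ and $B$ ranges over all $k\times k$ submatrices of $A$ (arbitrary choices of $k$ rows and $k$ columns). For a set system, $\operatorname{detlb}(\mathcal{F})=\operatorname{detlb}(A)$, where $A$ is the $m\times n$ incidence matrix of $\mathcal{F}$ ($A_{ij}=1$ if $j\in F_i$, and $0$ otherwise). $\log$ is the natural logarithm. *)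

theory Defs
  imports Complex_Main "HOL-Library.FuncSet"
    "Jordan_Normal_Form.Determinant" "Jordan_Normal_Form.DL_Submatrix"
begin

(* Colorings of V are extensional functions, so that there are finitely many of them.
   The inner maximum is meaningful for finite nonempty S only. *)
definition disc :: "'a set \<Rightarrow> 'a set set \<Rightarrow> real" where
  "disc V S = (MIN \<chi> \<in> V \<rightarrow>\<^sub>E {-1, 1}. MAX F \<in> S. \<bar>\<Sum>j\<in>F. \<chi> j\<bar>)"

definition restrict_system :: "'a set set \<Rightarrow> 'a set \<Rightarrow> 'a set set" where
  "restrict_system S J = {F \<inter> J |F. F \<in> S}"

definition herdisc :: "'a set \<Rightarrow> 'a set set \<Rightarrow> real" where
  "herdisc V S = (MAX J \<in> Pow V. disc J (restrict_system S J))"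

(* Meaningful for matrices with at least one row and one column. *)
definition detlb :: "real mat \<Rightarrow> real" where
  "detlb A = Max {root k \<bar>det (submatrix A I J)\<bar> |k I J.
     1 \<le> k \<and> I \<subseteq> {..<dim_row A} \<and> J \<subseteq> {..<dim_col A} \<and> card I = k \<and> card J = k}"

(* Matrix indices start at 0, whereas the sets F 1, ..., F m and the
   ground set {1..n} are numbered from 1. *)
definition incidence_mat :: "nat \<Rightarrow> nat \<Rightarrow> (nat \<Rightarrow> nat set) \<Rightarrow> real mat" where
  "incidence_mat m n F = mat m n (\<lambda>(i, j). if Suc j \<in> F (Suc i) then 1 else 0)"

end

(* Fix J and a scale L > detlb. A coloring of J is obtained by rounding the point 0 of the cube
   [-1,1]^J in phases that at least halve the number of coordinates strictly inside (-1,1).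
   With d_i(x) the signed sum of x over F_i, a phase minimises
   sum_i cosh(d_i(x) / (4L)) - K |x|^2, the coordinates already equal to 1 or -1 being fixed.
   If A is the set of coordinates inside (-1,1) at the minimiser, the second-order condition bounds
   the quadratic form of the incidence matrix on A, with row weights proportional to
   cosh(d_i(x) / (4L)), from below by a multiple of |u|^2. Expanding determinants along a row and
   averaging over the row produces a minor of order k = |A| with square at least c^k k!, hence k is
   at most 3 L^2 / c, and the choice of K makes this at most half of the number of free coordinates.
   A phase at most doubles the sum of the cosh terms, and there are about log n phases, so this sum
   ends up below 2mn and each |d_i| is at most 4 L ln(4mn).
   The factor sqrt(log n) is not produced by this argument; it only absorbs a constant. *)
theory Submission
  imports Defs "HOL-Analysis.Function_Topology"
begin

section \<open>Large minors from a lower bound on a weighted quadratic form\<close>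

lemma exists_ge_weighted_mean:
  fixes p X :: "'i \<Rightarrow> real"
  assumes "finite I" "\<And>i. i \<in> I \<Longrightarrow> 0 \<le> p i" "(\<Sum>i\<in>I. p i) = 1"
  shows "\<exists>i\<in>I. (\<Sum>i\<in>I. p i * X i) \<le> X i"
proof -
  have "I \<noteq> {}" using assms(3) by auto
  then have "Max (X ` I) \<in> X ` I" using assms(1) by (intro Max_in) auto
  then obtain i where i: "i \<in> I" "X i = Max (X ` I)" by auto
  have "(\<Sum>i\<in>I. p i * X i) \<le> (\<Sum>j\<in>I. p j * X i)"
    using assms i by (intro sum_mono mult_left_mono) auto
  also have "\<dots> = X i"
    using assms(3) by (simp flip: sum_distrib_right)
  finally show ?thesis using i by blast
qed

text \<open>Test the form on the vector that carries \<open>w\<close> along \<open>g\<close> and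
  vanishes on the rest of \<open>A\<close>. This makes the hypothesis usable on any selection of
  \<open>k\<close> columns.\<close>

lemma quadratic_form_lower_bound_reindex:
  fixes a :: "'i \<Rightarrow> 'j \<Rightarrow> real" and p :: "'i \<Rightarrow> real"
  assumes "finite A"
    and form: "\<And>u. c * (\<Sum>j\<in>A. (u j)\<^sup>2) \<le> (\<Sum>i\<in>I. p i * (\<Sum>j\<in>A. a i j * u j)\<^sup>2)"
    and g: "inj_on g {..<k}" "g ` {..<k} \<subseteq> A"
  shows "c * (\<Sum>s<k. (w s)\<^sup>2) \<le> (\<Sum>i\<in>I. p i * (\<Sum>s<k. a i (g s) * w s)\<^sup>2)"
proof -
  define u where "u j = (if j \<in> g ` {..<k} then w (inv_into {..<k} g j) else 0)" for j
  have u: "u (g s) = w s" if "s < k" for s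
    using that g by (simp add: u_def)
  have "(\<Sum>j\<in>A. h j (u j)) = (\<Sum>s<k. h (g s) (w s))" if "\<And>j. h j 0 = 0" for h :: "'j \<Rightarrow> real \<Rightarrow> real"
  proof -
    have "(\<Sum>j\<in>A. h j (u j)) = (\<Sum>j\<in>g ` {..<k}. h j (u j))"
      using assms that by (intro sum.mono_neutral_right) (auto simp: u_def)
    also have "\<dots> = (\<Sum>s<k. h (g s) (w s))"
      using g u by (simp add: sum.reindex)
    finally show ?thesis .
  qed
  from this[of "\<lambda>j x. x\<^sup>2"] this[of "\<lambda>j x. a _ j * x"] form[of u] show ?thesis
    by simp
qed

lemma insert_index_inj_on: "inj_on (insert_index s) A"
  by (auto simp: inj_on_def insert_index_def split: if_splits)

text \<open>A single choice of rows is needed for all the minors of an expansion at once,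
  hence the statement about a list of column selections.\<close>

lemma exists_large_minors:
  fixes a :: "'i \<Rightarrow> 'j \<Rightarrow> real" and p :: "'i \<Rightarrow> real"
  assumes "finite I" "finite A" "\<And>i. i \<in> I \<Longrightarrow> 0 \<le> p i" "(\<Sum>i\<in>I. p i) = 1" "0 \<le> c"
    and form: "\<And>u. c * (\<Sum>j\<in>A. (u j)\<^sup>2) \<le> (\<Sum>i\<in>I. p i * (\<Sum>j\<in>A. a i j * u j)\<^sup>2)"
  shows "(\<And>g. g \<in> set G \<Longrightarrow> inj_on g {..<k} \<and> g ` {..<k} \<subseteq> A) \<Longrightarrow>
    \<exists>f. f ` {..<k} \<subseteq> I \<and>
      c ^ k * fact k * length G \<le> (\<Sum>g\<leftarrow>G. (det (mat k k (\<lambda>(r, s). a (f r) (g s))))\<^sup>2)"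
proof (induction k arbitrary: G)
  case 0
  then show ?case by (simp add: sum_list_triv det_dim_zero)
next
  case (Suc k)
  \<comment> \<open>The composition with \<open>insert_index s\<close> drops the \<open>s\<close>-th
    of the \<open>Suc k\<close> selected columns. So \<open>G'\<close> lists the column selections
    of all minors that occur when the new last row is expanded, for every \<open>g\<close> in
    \<open>G\<close>.\<close>
  define G' where "G' = concat (map (\<lambda>g. map (\<lambda>s. g \<circ> insert_index s) [0..<Suc k]) G)"
  have "inj_on h {..<k} \<and> h ` {..<k} \<subseteq> A" if h: "h \<in> set G'" for h
  proof -
    obtain g s where g: "g \<in> set G" "s < Suc k" "h = g \<circ> insert_index s"
      using h unfolding G'_def by (auto simp del: upt_Suc)
    have "insert_index s ` {..<k} \<subseteq> {..<Suc k}"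
      by (auto simp: insert_index_def)
    then show ?thesis
      using Suc.prems[OF g(1)] g(3) insert_index_inj_on[of s "{..<k}"]
      by (auto intro!: comp_inj_on intro: inj_on_subset)
  qed
  from Suc.IH[OF this] obtain f where f: "f ` {..<k} \<subseteq> I"
    "c ^ k * fact k * length G' \<le> (\<Sum>g\<leftarrow>G'. (det (mat k k (\<lambda>(r, s). a (f r) (g s))))\<^sup>2)"
    by blast
  define M where "M g s = det (mat k k (\<lambda>(r, t). a (f r) (g (insert_index s t))))" for g s
  \<comment> \<open>Row \<open>i\<close> is the candidate for the last row. It has to serve all of
    \<open>G\<close> simultaneously.\<close>
  define D where "D i g = det (mat (Suc k) (Suc k) (\<lambda>(r, s). a ((f(k := i)) r) (g s)))" for i g
  have len: "length G' = Suc k * length G"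
    by (simp add: G'_def length_concat o_def sum_list_triv del: upt_Suc)
  have G'_sum: "(\<Sum>g\<leftarrow>G'. (det (mat k k (\<lambda>(r, s). a (f r) (g s))))\<^sup>2)
      = (\<Sum>g\<leftarrow>G. \<Sum>s<Suc k. (M g s)\<^sup>2)"
    unfolding G'_def M_def
    by (induction G)
      (simp_all add: o_def interv_sum_list_conv_sum_set_nat atLeast0LessThan
        del: upt_Suc sum.lessThan_Suc)
  have D: "D i g = (\<Sum>s<Suc k. a i (g s) * ((-1) ^ (k + s) * M g s))" for i g
  proof -
    let ?A = "mat (Suc k) (Suc k) (\<lambda>(r, s). a ((f(k := i)) r) (g s))"
    have "mat_delete ?A k s = mat k k (\<lambda>(r, t). a (f r) (g (insert_index s t)))" if "s < Suc k" for s
      using that by (intro eq_matI) (auto simp: mat_delete_def insert_index_def)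
    then show ?thesis
      unfolding D_def M_def
      by (subst laplace_expansion_row[of _ "Suc k" k])
        (auto simp: cofactor_def simp del: sum.lessThan_Suc intro!: sum.cong)
  qed
  \<comment> \<open>By the expansion, \<open>D i g\<close> is the linear form of row
    \<open>i\<close> evaluated at the vector of signed minors. The quadratic form bound is applied
    to that vector; the signs disappear in the squares.\<close>
  have key: "c * (\<Sum>s<Suc k. (M g s)\<^sup>2) \<le> (\<Sum>i\<in>I. p i * (D i g)\<^sup>2)" if "g \<in> set G" for g
    using quadratic_form_lower_bound_reindex[OF \<open>finite A\<close> form, of g "Suc k" "\<lambda>s. (-1) ^ (k + s) * M g s"]
      Suc.prems[OF that] unfolding D
    by (simp add: power_mult_distrib flip: power_mult del: sum.lessThan_Suc)
  \<comment> \<open>The factor \<open>Suc k\<close> of the factorial comes from the length of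
    \<open>G'\<close>.\<close>
  have "c ^ Suc k * fact (Suc k) * length G = c * (c ^ k * fact k * length G')"
    by (simp add: len algebra_simps)
  also have "\<dots> \<le> c * (\<Sum>g\<leftarrow>G. \<Sum>s<Suc k. (M g s)\<^sup>2)"
    using f(2) \<open>0 \<le> c\<close> unfolding G'_sum by (rule mult_left_mono)
  also have "\<dots> = (\<Sum>g\<leftarrow>G. c * (\<Sum>s<Suc k. (M g s)\<^sup>2))"
    by (rule sum_list_const_mult[symmetric])
  also have "\<dots> \<le> (\<Sum>g\<leftarrow>G. \<Sum>i\<in>I. p i * (D i g)\<^sup>2)"
    using key by (rule sum_list_mono)
  also have "\<dots> = (\<Sum>i\<in>I. p i * (\<Sum>g\<leftarrow>G. (D i g)\<^sup>2))"
    by (induction G) (simp_all add: sum.distrib distrib_left)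
  finally have le: "c ^ Suc k * fact (Suc k) * length G \<le> (\<Sum>i\<in>I. p i * (\<Sum>g\<leftarrow>G. (D i g)\<^sup>2))" .
  obtain i where i: "i \<in> I" "(\<Sum>i\<in>I. p i * (\<Sum>g\<leftarrow>G. (D i g)\<^sup>2)) \<le> (\<Sum>g\<leftarrow>G. (D i g)\<^sup>2)"
    using exists_ge_weighted_mean[OF assms(1,3,4), of "\<lambda>i. \<Sum>g\<leftarrow>G. (D i g)\<^sup>2"] by blast
  have "(f(k := i)) ` {..<Suc k} \<subseteq> I"
    using f(1) i(1) by (auto simp: less_Suc_eq)
  moreover have "c ^ Suc k * fact (Suc k) * length G
      \<le> (\<Sum>g\<leftarrow>G. (det (mat (Suc k) (Suc k) (\<lambda>(r, s). a ((f(k := i)) r) (g s))))\<^sup>2)"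
    using le i(2) unfolding D_def by linarith
  ultimately show ?case by blast
qed

text \<open>One term of the exponential series at \<open>k\<close> is at most the whole sum. This
  serves as the Stirling-type bound k! \<ge> (k/e)^k.\<close>

lemma power_le_exp_mult_fact: "real k ^ k \<le> exp (real k) * fact k"
proof -
  have "(\<Sum>n\<in>{k}. real k ^ n /\<^sub>R fact n) \<le> (\<Sum>n. real k ^ n /\<^sub>R fact n)"
    by (intro sum_le_suminf summable_exp_generic) auto
  then show ?thesis
    by (simp add: exp_def field_simps)
qed

text \<open>Taking all of \<open>A\<close> as columns gives a minor of order
  \<open>k = card A\<close> whose square lies between \<open>c ^ k * fact k\<close> and
  \<open>L ^ (2 * k)\<close>. Bounding the factorial below by (k/3)^k and taking k-th roots leaves
  the claim.\<close>

lemma quadratic_form_dimension_bound: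
  fixes a :: "'i \<Rightarrow> 'j \<Rightarrow> real" and p :: "'i \<Rightarrow> real"
  assumes "finite I" "finite A" "\<And>i. i \<in> I \<Longrightarrow> 0 \<le> p i" "(\<Sum>i\<in>I. p i) = 1" "0 \<le> c" "0 \<le> L"
    and form: "\<And>u. c * (\<Sum>j\<in>A. (u j)\<^sup>2) \<le> (\<Sum>i\<in>I. p i * (\<Sum>j\<in>A. a i j * u j)\<^sup>2)"
    and minors: "\<And>k f g. \<lbrakk>1 \<le> k; inj_on f {..<k}; inj_on g {..<k}; f ` {..<k} \<subseteq> I; g ` {..<k} \<subseteq> A\<rbrakk>
      \<Longrightarrow> \<bar>det (mat k k (\<lambda>(r, s). a (f r) (g s)))\<bar> \<le> L ^ k"
  shows "c * card A \<le> 3 * L\<^sup>2"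
proof (cases "A = {}")
  case True
  then show ?thesis by simp
next
  case False
  define k where "k = card A"
  have k: "1 \<le> k" using False \<open>finite A\<close> by (simp add: k_def Suc_le_eq card_gt_0_iff)
  obtain g where g: "bij_betw g {..<k} A"
    using ex_bij_betw_nat_finite[OF \<open>finite A\<close>] unfolding k_def atLeast0LessThan by blast
  then have g': "inj_on g {..<k}" "g ` {..<k} \<subseteq> A"
    by (auto simp: bij_betw_def)
  obtain f where f: "f ` {..<k} \<subseteq> I"
    "c ^ k * fact k \<le> (det (mat k k (\<lambda>(r, s). a (f r) (g s))))\<^sup>2"
    using exists_large_minors[OF assms(1-5) form, of "[g]" k] g' by auto
  let ?B = "mat k k (\<lambda>(r, s). a (f r) (g s))"
  have "\<bar>det ?B\<bar> \<le> L ^ k"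
  proof (cases "inj_on f {..<k}")
    case True
    then show ?thesis using minors k f g' by blast
  next
    \<comment> \<open>The averaging argument may select the same row twice. The determinant then
      vanishes and the bound is trivial.\<close>
    case False
    then obtain r s where "r < k" "s < k" "r \<noteq> s" "f r = f s"
      by (auto simp: inj_on_def)
    then have "det ?B = 0"
      by (intro det_identical_rows[of _ k r s]) (auto intro!: eq_vecI)
    then show ?thesis using \<open>0 \<le> L\<close> by simp
  qed
  then have minor_le: "c ^ k * fact k \<le> (L ^ k)\<^sup>2"
    using f(2) abs_le_square_iff[of "det ?B" "L ^ k"] \<open>0 \<le> L\<close> by simp
  have exp_le_power: "exp (real k) \<le> 3 ^ k"
    using power_mono[OF exp_le, of k] by (simp flip: exp_of_nat_mult)
  have "(c * k) ^ k \<le> c ^ k * (exp (real k) * fact k)"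
    using power_le_exp_mult_fact \<open>0 \<le> c\<close> unfolding power_mult_distrib by (intro mult_left_mono) auto
  also have "\<dots> = exp (real k) * (c ^ k * fact k)"
    by simp
  also have "\<dots> \<le> 3 ^ k * (L ^ k)\<^sup>2"
    using minor_le exp_le_power \<open>0 \<le> c\<close> by (intro mult_mono) auto
  also have "\<dots> = (3 * L\<^sup>2) ^ k"
    by (simp add: power_mult_distrib mult.commute flip: power_mult)
  finally have "(c * k) ^ k \<le> (3 * L\<^sup>2) ^ k" .
  \<comment> \<open>The cancellation rule \<open>power_le_imp_le_base\<close> is stated for
    exponents of the form \<open>Suc n\<close>.\<close>
  moreover have "k = Suc (k - 1)" using k by simp
  ultimately have "c * k \<le> 3 * L\<^sup>2"
    by (metis power_le_imp_le_base mult_nonneg_nonneg zero_le_power2 zero_le_numeral)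
  then show ?thesis by (simp add: k_def)
qed


section \<open>Hyperbolic cosine estimates and minimisation over a box\<close>

text \<open>For z = |y|, the bound on exp (-z) rests on (1 - z + z^2)(1 + z) = 1 + z^3 \<ge> 1.
  Averaging it with the bound on exp z cancels the linear terms.\<close>

lemma cosh_le_one_plus_square:
  fixes y :: real
  assumes "\<bar>y\<bar> \<le> 1"
  shows "cosh y \<le> 1 + y\<^sup>2"
proof -
  define z where "z = \<bar>y\<bar>"
  have z: "0 \<le> z" "z \<le> 1" using assms by (auto simp: z_def)
  have "exp z \<le> 1 + z + z\<^sup>2" using exp_bound[OF z] .
  moreover have "exp (- z) \<le> 1 - z + z\<^sup>2"
  proof -
    have "1 \<le> (1 - z + z\<^sup>2) * (1 + z)"
      using z by (simp add: algebra_simps power2_eq_square)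
    also have "\<dots> \<le> (1 - z + z\<^sup>2) * exp z"
      using z by (intro mult_left_mono exp_ge_add_one_self) auto
    finally show ?thesis
      by (simp add: exp_minus field_simps)
  qed
  ultimately have "cosh z \<le> 1 + z\<^sup>2"
    by (simp add: cosh_field_def)
  then show ?thesis by (simp add: z_def)
qed

lemma cosh_plus_cosh: "cosh (x + y) + cosh (x - y) = 2 * cosh x * cosh (y :: real)"
  by (simp add: cosh_add cosh_diff)

text \<open>A product of compact sets is compact by Tychonoff's theorem, so the index type may be
  infinite. Singleton factors pin coordinates.\<close>

lemma continuous_attains_inf_box:
  fixes h :: "('j \<Rightarrow> real) \<Rightarrow> real"
  assumes "continuous_on UNIV h" "\<And>j. compact (S j)" "\<And>j. S j \<noteq> {}"
  obtains x where "\<And>j. x j \<in> S j" "\<And>y. (\<And>j. y j \<in> S j) \<Longrightarrow> h x \<le> h y"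
proof -
  have "compact (PiE UNIV S)"
    using assms(2) compactin_PiE[of "\<lambda>_. euclidean" UNIV S]
    by (simp add: euclidean_product_topology)
  moreover have "PiE UNIV S \<noteq> {}" using assms(3) by (simp add: PiE_eq_empty_iff)
  moreover have "continuous_on (PiE UNIV S) h"
    using assms(1) by (rule continuous_on_subset) auto
  ultimately have "\<exists>x\<in>PiE UNIV S. \<forall>y\<in>PiE UNIV S. h x \<le> h y"
    by (rule continuous_attains_inf)
  then obtain x where x: "x \<in> PiE UNIV S" "\<forall>y\<in>PiE UNIV S. h x \<le> h y" ..
  show thesis
  proof (rule that[of x])
    show "x j \<in> S j" for j using x(1) by (rule PiE_mem) simp
    show "h x \<le> h y" if "\<And>j. y j \<in> S j" for y
      using x(2) that by (simp add: PiE_UNIV_domain)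
  qed
qed

section \<open>Rounding by a potential function\<close>

text \<open>Minors are indexed by injective maps, not by sets, because the averaging argument
  delivers its rows in arbitrary order.\<close>

locale bounded_minors =
  fixes I :: "'i set" and V :: "'j set" and a :: "'i \<Rightarrow> 'j \<Rightarrow> real" and L :: real
  assumes finite_I: "finite I" and I_nonempty: "I \<noteq> {}" and finite_V: "finite V" and L_pos: "0 < L"
    and minors: "\<And>k f g. \<lbrakk>1 \<le> k; inj_on f {..<k}; inj_on g {..<k}; f ` {..<k} \<subseteq> I; g ` {..<k} \<subseteq> V\<rbrakk>
      \<Longrightarrow> \<bar>det (mat k k (\<lambda>(r, s). a (f r) (g s)))\<bar> \<le> L ^ k"
begin

text \<open>The 4 enters the second-order estimate as its square 16; a factor of at least 12 is what
  halving the number of free coordinates requires.\<close>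

definition potential :: "('j \<Rightarrow> real) \<Rightarrow> real" where
  "potential x = (\<Sum>i\<in>I. cosh ((\<Sum>j\<in>V. a i j * x j) / (4 * L)))"

definition alive :: "('j \<Rightarrow> real) \<Rightarrow> 'j set" where
  "alive x = {j \<in> V. \<bar>x j\<bar> < 1}"

lemma potential_pos: "0 < potential x"
  unfolding potential_def using finite_I I_nonempty by (intro sum_pos) auto

lemma finite_alive: "finite (alive x)"
  using finite_V by (simp add: alive_def)

text \<open>At a minimiser of \<open>\<Psi>\<close>, comparison with \<open>x0\<close> controls the
  potential, while the second-order condition controls how many coordinates remain in the
  interior.\<close>

lemma halve_alive:
  assumes x0: "\<And>j. j \<in> V \<Longrightarrow> \<bar>x0 j\<bar> \<le> 1" and "alive x0 \<noteq> {}"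
  obtains x where "\<And>j. j \<in> V \<Longrightarrow> \<bar>x j\<bar> \<le> 1" "potential x \<le> 2 * potential x0"
    "2 * card (alive x) \<le> card (alive x0)"
proof -
  define A0 where "A0 = alive x0"
  \<comment> \<open>With this \<open>K\<close> the subtracted quadratic term is at most
    \<open>potential x0\<close> on the whole box, which is why the potential at most
    doubles.\<close>
  define K where "K = potential x0 / card A0"
  have A0: "A0 \<subseteq> V" "finite A0" "A0 \<noteq> {}"
    using assms finite_alive by (auto simp: A0_def alive_def)
  then have card_A0: "0 < card A0" by (simp add: card_gt_0_iff)
  then have "0 < K" using potential_pos by (simp add: K_def)
  define S where "S j = (if j \<in> A0 then {-1..1} else {x0 j})" for j
  define \<Psi> where "\<Psi> x = potential x - K * (\<Sum>j\<in>A0. (x j)\<^sup>2)" for x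
  have "continuous_on UNIV \<Psi>"
    unfolding \<Psi>_def potential_def using L_pos
    by (intro continuous_intros continuous_on_product_coordinates) auto
  then obtain x where x: "\<And>j. x j \<in> S j" and min: "\<And>y. (\<And>j. y j \<in> S j) \<Longrightarrow> \<Psi> x \<le> \<Psi> y"
    by (rule continuous_attains_inf_box[of \<Psi> S]) (auto simp: S_def)
  have x_A0: "\<bar>x j\<bar> \<le> 1" if "j \<in> A0" for j
    using x[of j] that by (auto simp: S_def)
  have x_fixed: "x j = x0 j" if "j \<notin> A0" for j
    using x[of j] that by (simp add: S_def)
  have bound: "\<bar>x j\<bar> \<le> 1" if "j \<in> V" for j
    using x_A0 x_fixed x0 that by (cases "j \<in> A0") auto
  have "\<bar>x0 j\<bar> < 1" if "j \<in> A0" for j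
    using that by (simp add: A0_def alive_def)
  then have "\<Psi> x \<le> \<Psi> x0"
    by (intro min) (fastforce simp: S_def abs_less_iff)
  moreover have "(\<Sum>j\<in>A0. (x j)\<^sup>2) \<le> (\<Sum>j\<in>A0. 1)"
    using x_A0 by (intro sum_mono) (simp add: abs_square_le_1)
  then have "K * (\<Sum>j\<in>A0. (x j)\<^sup>2) \<le> K * card A0"
    using \<open>0 < K\<close> by simp
  moreover have "0 \<le> K * (\<Sum>j\<in>A0. (x0 j)\<^sup>2)"
    using \<open>0 < K\<close> by (simp add: sum_nonneg)
  moreover have "K * card A0 = potential x0"
    using card_A0 by (simp add: K_def)
  ultimately have pot: "potential x \<le> 2 * potential x0"
    unfolding \<Psi>_def by linarith

  define A where "A = alive x"
  have "A \<subseteq> A0"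
    using x_fixed x0 by (force simp: A_def A0_def alive_def)
  then have "finite A" "A \<subseteq> V" using A0 by (auto intro: finite_subset)
  define d where "d i = (\<Sum>j\<in>V. a i j * x j) / (4 * L)" for i
  \<comment> \<open>The minimiser is compared with both \<open>x + t v\<close> and
    \<open>x - t v\<close>, where \<open>v\<close> extends \<open>u\<close> by zero. Adding the two
    inequalities cancels the odd terms, so no derivatives are needed.\<close>
  have second_order: "K * (\<Sum>j\<in>A. (u j)\<^sup>2)
      \<le> (\<Sum>i\<in>I. cosh (d i) * ((\<Sum>j\<in>A. a i j * u j) / (4 * L))\<^sup>2)" for u
  proof -
    define v where "v j = (if j \<in> A then u j else 0)" for j
    define e where "e i = (\<Sum>j\<in>A. a i j * u j) / (4 * L)" for i
    have v_sum: "(\<Sum>j\<in>V. a i j * v j) = (\<Sum>j\<in>A. a i j * u j)" for i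
      using \<open>A \<subseteq> V\<close> finite_V unfolding v_def
      by (intro sum.mono_neutral_cong_right) auto
    have v_sq: "(\<Sum>j\<in>A0. (v j)\<^sup>2) = (\<Sum>j\<in>A. (u j)\<^sup>2)"
      using \<open>A \<subseteq> A0\<close> A0(2) unfolding v_def
      by (intro sum.mono_neutral_cong_right) auto
    \<comment> \<open>Coordinates in \<open>A\<close> lie strictly inside the interval, so both
      perturbations stay in the box for small \<open>t\<close>. Below, \<open>t\<close> is also made
      small enough for the quadratic bound on cosh.\<close>
    have "eventually (\<lambda>t. \<forall>j\<in>A. \<bar>x j\<bar> + \<bar>t * u j\<bar> < 1) (at_right (0::real))"
    proof (intro eventually_ball_finite \<open>finite A\<close> ballI)
      fix j assume "j \<in> A"
      then have "\<bar>x j\<bar> < 1" by (simp add: A_def alive_def)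
      moreover have "((\<lambda>t. \<bar>x j\<bar> + \<bar>t * u j\<bar>) \<longlongrightarrow> \<bar>x j\<bar> + \<bar>0 * u j\<bar>) (at_right 0)"
        by (intro tendsto_intros)
      ultimately show "eventually (\<lambda>t. \<bar>x j\<bar> + \<bar>t * u j\<bar> < 1) (at_right 0)"
        by (intro order_tendstoD) auto
    qed
    moreover have "eventually (\<lambda>t. \<forall>i\<in>I. \<bar>t * e i\<bar> < 1) (at_right (0::real))"
    proof (intro eventually_ball_finite finite_I ballI)
      fix i
      have "((\<lambda>t. \<bar>t * e i\<bar>) \<longlongrightarrow> \<bar>0 * e i\<bar>) (at_right 0)"
        by (intro tendsto_intros)
      then show "eventually (\<lambda>t. \<bar>t * e i\<bar> < 1) (at_right 0)"
        by (intro order_tendstoD) auto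
    qed
    moreover have "eventually (\<lambda>t. 0 < t) (at_right (0::real))"
      by (rule eventually_at_right_less)
    ultimately have "eventually (\<lambda>t. 0 < t \<and> (\<forall>j\<in>A. \<bar>x j\<bar> + \<bar>t * u j\<bar> < 1) \<and> (\<forall>i\<in>I. \<bar>t * e i\<bar> < 1))
        (at_right (0::real))"
      by eventually_elim blast
    from eventually_happens'[OF trivial_limit_at_right_real this]
    obtain t where t: "0 < t" "\<And>j. j \<in> A \<Longrightarrow> \<bar>x j\<bar> + \<bar>t * u j\<bar> < 1" "\<And>i. i \<in> I \<Longrightarrow> \<bar>t * e i\<bar> < 1"
      by blast
    have "\<Psi> x \<le> \<Psi> (\<lambda>j. x j + \<sigma> * t * v j)" if "\<bar>\<sigma>\<bar> = 1" for \<sigma>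
    proof (rule min)
      fix j
      show "x j + \<sigma> * t * v j \<in> S j"
      proof (cases "j \<in> A")
        case True
        have "\<bar>\<sigma> * t * v j\<bar> = \<bar>t * u j\<bar>"
          using True that by (simp add: v_def abs_mult)
        then have "\<bar>x j + \<sigma> * t * v j\<bar> \<le> 1"
          using t(2)[OF True] by linarith
        then show ?thesis
          using True \<open>A \<subseteq> A0\<close> by (auto simp: S_def abs_le_iff)
      next
        case False
        then show ?thesis using x[of j] by (simp add: v_def)
      qed
    qed
    from this[of 1] this[of "-1"]
    have "2 * \<Psi> x \<le> \<Psi> (\<lambda>j. x j + t * v j) + \<Psi> (\<lambda>j. x j - t * v j)"
      by simp
    also have "\<dots> = (\<Sum>i\<in>I. cosh (d i + t * e i) + cosh (d i - t * e i))
        - K * (\<Sum>j\<in>A0. (x j + t * v j)\<^sup>2 + (x j - t * v j)\<^sup>2)"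
    proof -
      have sums: "(\<Sum>j\<in>V. a i j * (x j + t * v j)) / (4 * L) = d i + t * e i"
        "(\<Sum>j\<in>V. a i j * (x j - t * v j)) / (4 * L) = d i - t * e i" for i
        unfolding d_def e_def v_sum[symmetric]
        by (simp_all add: algebra_simps sum.distrib sum_subtractf sum_distrib_left
            add_divide_distrib diff_divide_distrib)
      then show ?thesis
        unfolding \<Psi>_def potential_def sums sum.distrib distrib_left by simp
    qed
    also have "(\<Sum>i\<in>I. cosh (d i + t * e i) + cosh (d i - t * e i))
        = 2 * (\<Sum>i\<in>I. cosh (d i) * cosh (t * e i))"
      by (simp add: cosh_plus_cosh sum_distrib_left mult.assoc)
    also have "(\<Sum>j\<in>A0. (x j + t * v j)\<^sup>2 + (x j - t * v j)\<^sup>2)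
        = 2 * (\<Sum>j\<in>A0. (x j)\<^sup>2) + 2 * t\<^sup>2 * (\<Sum>j\<in>A. (u j)\<^sup>2)"
      unfolding v_sq[symmetric]
      by (simp add: sum_distrib_left sum.distrib[symmetric] power2_eq_square algebra_simps)
    finally have "potential x + K * t\<^sup>2 * (\<Sum>j\<in>A. (u j)\<^sup>2) \<le> (\<Sum>i\<in>I. cosh (d i) * cosh (t * e i))"
      by (simp add: \<Psi>_def algebra_simps)
    also have "\<dots> \<le> (\<Sum>i\<in>I. cosh (d i) * (1 + (t * e i)\<^sup>2))"
      using t(3) by (intro sum_mono mult_left_mono cosh_le_one_plus_square) (auto intro: less_imp_le)
    also have "\<dots> = potential x + t\<^sup>2 * (\<Sum>i\<in>I. cosh (d i) * (e i)\<^sup>2)"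
      by (simp add: potential_def d_def distrib_left sum.distrib sum_distrib_left power_mult_distrib
          mult.left_commute)
    finally have "t\<^sup>2 * (K * (\<Sum>j\<in>A. (u j)\<^sup>2)) \<le> t\<^sup>2 * (\<Sum>i\<in>I. cosh (d i) * (e i)\<^sup>2)"
      by (simp add: algebra_simps)
    then show ?thesis
      using t(1) by (simp add: e_def)
  qed

  \<comment> \<open>Normalising the cosh weights to total 1 turns the second-order condition into
    the form required by the dimension bound, with the scaling by \<open>4 * L\<close> moved into
    \<open>c\<close>.\<close>
  define p where "p i = cosh (d i) / potential x" for i
  define c where "c = 16 * L\<^sup>2 * K / potential x"
  have pot_d: "potential x = (\<Sum>i\<in>I. cosh (d i))"
    by (simp add: potential_def d_def)
  have "c * card A \<le> 3 * L\<^sup>2"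
  proof (rule quadratic_form_dimension_bound[where I = I and a = a and p = p])
    show "(\<Sum>i\<in>I. p i) = 1"
      using potential_pos[of x] unfolding p_def by (simp add: pot_d flip: sum_divide_distrib)
    show "c * (\<Sum>j\<in>A. (u j)\<^sup>2) \<le> (\<Sum>i\<in>I. p i * (\<Sum>j\<in>A. a i j * u j)\<^sup>2)" for u
    proof -
      have "c * (\<Sum>j\<in>A. (u j)\<^sup>2) = 16 * L\<^sup>2 / potential x * (K * (\<Sum>j\<in>A. (u j)\<^sup>2))"
        by (simp add: c_def)
      also have "\<dots> \<le> 16 * L\<^sup>2 / potential x *
          (\<Sum>i\<in>I. cosh (d i) * ((\<Sum>j\<in>A. a i j * u j) / (4 * L))\<^sup>2)"
        using second_order potential_pos[of x] by (intro mult_left_mono) auto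
      also have "\<dots> = (\<Sum>i\<in>I. p i * (\<Sum>j\<in>A. a i j * u j)\<^sup>2)"
        using L_pos unfolding sum_distrib_left
        by (intro sum.cong) (auto simp: p_def power_divide power_mult_distrib)
      finally show ?thesis .
    qed
    show "0 \<le> p i" for i
      using potential_pos[of x] by (simp add: p_def)
    show "0 \<le> c"
      using potential_pos[of x] \<open>0 < K\<close> by (simp add: c_def)
    show "\<bar>det (mat k k (\<lambda>(r, s). a (f r) (g s)))\<bar> \<le> L ^ k"
      if "1 \<le> k" "inj_on f {..<k}" "inj_on g {..<k}" "f ` {..<k} \<subseteq> I" "g ` {..<k} \<subseteq> A" for k f g
      using minors[of k f g] that \<open>A \<subseteq> V\<close> by blast
  qed (use finite_I \<open>finite A\<close> L_pos in auto)
  then have "L\<^sup>2 * (16 * K * card A) \<le> L\<^sup>2 * (3 * potential x)"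
    using potential_pos[of x] by (simp add: c_def field_simps)
  \<comment> \<open>The doubling bound turns 3 into 6, and inserting \<open>K\<close> gives card A
    \<le> (6/16) card A0, which is below one half.\<close>
  then have "16 * K * card A \<le> 6 * potential x0"
    using L_pos pot by (simp add: mult_le_cancel_left_pos)
  then have "potential x0 * (16 * card A) \<le> potential x0 * (6 * card A0)"
    using card_A0 by (simp add: K_def field_simps)
  then have "16 * real (card A) \<le> 6 * real (card A0)"
    using potential_pos[of x0] by (simp add: mult_le_cancel_left_pos)
  then have "2 * card A \<le> card A0" by linarith
  then have "2 * card (alive x) \<le> card (alive x0)" by (simp add: A_def A0_def)
  then show thesis by (intro that[of x] bound pot)
qed

text \<open>A phase at most doubles the potential and at least halves the number of free
  coordinates, so their product does not grow. The extra factor 2 pays for the phase that leaves no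
  free coordinate; \<open>max 1\<close> covers a start without any.\<close>

lemma exists_rounding:
  assumes "\<And>j. j \<in> V \<Longrightarrow> \<bar>x0 j\<bar> \<le> 1"
  shows "\<exists>x. (\<forall>j\<in>V. \<bar>x j\<bar> = 1) \<and> potential x \<le> 2 * max 1 (card (alive x0)) * potential x0"
  using assms
proof (induction "card (alive x0)" arbitrary: x0 rule: less_induct)
  case less
  show ?case
  proof (cases "alive x0 = {}")
    case True
    then have "\<forall>j\<in>V. \<bar>x0 j\<bar> = 1"
      using less.prems by (force simp: alive_def)
    moreover have "potential x0 \<le> 2 * max 1 (card (alive x0)) * potential x0"
      using potential_pos[of x0] True by simp
    ultimately show ?thesis by blast
  next
    case False
    then have pos: "0 < card (alive x0)"
      using finite_alive by (simp add: card_gt_0_iff)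
    obtain y where y: "\<And>j. j \<in> V \<Longrightarrow> \<bar>y j\<bar> \<le> 1" "potential y \<le> 2 * potential x0"
      "2 * card (alive y) \<le> card (alive x0)"
      using halve_alive[OF less.prems False] by blast
    show ?thesis
    proof (cases "alive y = {}")
      case True
      then have "\<forall>j\<in>V. \<bar>y j\<bar> = 1"
        using y(1) by (force simp: alive_def)
      moreover have "1 * potential x0 \<le> max 1 (card (alive x0)) * potential x0"
        using potential_pos[of x0] by (intro mult_right_mono) auto
      ultimately show ?thesis using y(2) by (intro exI[of _ y]) auto
    next
      case False
      then have pos': "0 < card (alive y)"
        using finite_alive by (simp add: card_gt_0_iff)
      obtain x where x: "\<forall>j\<in>V. \<bar>x j\<bar> = 1" "potential x \<le> 2 * max 1 (card (alive y)) * potential y"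
        using less.hyps[of y] y pos by force
      note x(2)
      also have "2 * max 1 (card (alive y)) * potential y \<le> 2 * card (alive y) * (2 * potential x0)"
        using y(2) pos' by (simp add: max_def)
      also have "\<dots> \<le> card (alive x0) * (2 * potential x0)"
        using y(3) potential_pos[of x0] by (intro mult_right_mono) linarith+
      also have "\<dots> = 2 * max 1 (card (alive x0)) * potential x0"
        using pos by (simp add: max_def)
      finally show ?thesis using x(1) by blast
    qed
  qed
qed

text \<open>Rounding starts at 0, where every cosh is 1 and the potential is \<open>card I\<close>.
  At the end a single cosh is at most the whole potential, and exp y \<le> 2 cosh y converts this
  into a logarithmic bound.\<close>

lemma exists_low_discrepancy_coloring:
  "\<exists>\<chi>\<in>V \<rightarrow>\<^sub>E {-1, 1}. \<forall>i\<in>I. \<bar>\<Sum>j\<in>V. a i j * \<chi> j\<bar> \<le> 4 * L * ln (4 * max 1 (card V) * card I)"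
proof -
  obtain x where x: "\<forall>j\<in>V. \<bar>x j\<bar> = 1"
    "potential x \<le> 2 * max 1 (card (alive (\<lambda>_. 0))) * potential (\<lambda>_. 0)"
    using exists_rounding[of "\<lambda>_. 0"] by auto
  have le: "potential x \<le> 2 * max 1 (card V) * card I"
    using x(2) by (simp add: potential_def alive_def)
  define \<chi> where "\<chi> = restrict x V"
  have "\<chi> \<in> V \<rightarrow>\<^sub>E {-1, 1}"
    using x(1) by (auto simp: \<chi>_def abs_if split: if_splits)
  moreover have "\<bar>\<Sum>j\<in>V. a i j * \<chi> j\<bar> \<le> 4 * L * ln (4 * max 1 (card V) * card I)" if "i \<in> I" for i
  proof -
    define y where "y = \<bar>(\<Sum>j\<in>V. a i j * x j) / (4 * L)\<bar>"
    have "exp y \<le> 2 * cosh y"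
      by (simp add: cosh_field_def)
    also have "cosh y \<le> potential x"
      unfolding potential_def y_def cosh_real_abs
      using that finite_I by (intro member_le_sum) auto
    finally have "exp y \<le> 4 * max 1 (card V) * card I"
      using le by simp
    then have "y \<le> ln (4 * max 1 (card V) * card I)"
      by (subst ln_ge_iff) (use exp_gt_zero[of y] in linarith)+
    then have "\<bar>\<Sum>j\<in>V. a i j * x j\<bar> \<le> 4 * L * ln (4 * max 1 (card V) * card I)"
      using L_pos by (simp add: y_def abs_divide field_simps)
    then show ?thesis by (simp add: \<chi>_def)
  qed
  ultimately show ?thesis by blast
qed

end

section \<open>Minors along injective maps and the determinant lower bound\<close>

text \<open>\<open>submatrix\<close> lists its rows in increasing order through \<open>pick\<close>,
  so an injective selection differs from it by a permutation.\<close>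

lemma permutation_to_pick:
  assumes f: "inj_on f {..<k}"
  obtains \<pi> where "\<pi> permutes {0..<k}" "\<And>r. r < k \<Longrightarrow> f r = pick (f ` {..<k}) (\<pi> r)"
proof -
  let ?I = "f ` {..<k}"
  have card: "card ?I = k" using f by (simp add: card_image)
  \<comment> \<open>This is the rank of \<open>f r\<close> in the image, counted from 0, and the
    identity beyond \<open>k\<close> as \<open>permutes\<close> demands.\<close>
  define \<pi> where "\<pi> r = (if r < k then card {a \<in> ?I. a < f r} else r)" for r
  have pick: "f r = pick ?I (\<pi> r)" if "r < k" for r
    using that pick_card_in_set[of "f r" ?I] by (simp add: \<pi>_def)
  have "\<pi> r < k" if "r < k" for r
  proof -
    have "card {a \<in> ?I. a < f r} < card ?I"
      using that by (intro psubset_card_mono) auto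
    then show ?thesis using card that by (simp add: \<pi>_def)
  qed
  moreover have "inj_on \<pi> {0..<k}"
  proof (rule inj_onI)
    fix r s assume "r \<in> {0..<k}" "s \<in> {0..<k}" "\<pi> r = \<pi> s"
    then have "f r = f s" using pick[of r] pick[of s] by simp
    then show "r = s" using f \<open>r \<in> _\<close> \<open>s \<in> _\<close> by (auto dest: inj_onD)
  qed
  ultimately have "bij_betw \<pi> {0..<k} {0..<k}"
    unfolding bij_betw_def by (intro conjI endo_inj_surj) auto
  then have "\<pi> permutes {0..<k}"
    by (rule bij_imp_permutes) (simp add: \<pi>_def)
  with pick show thesis using that by blast
qed

lemma abs_det_permute_rows:
  fixes A :: "real mat"
  assumes "A \<in> carrier_mat n n" "\<pi> permutes {0..<n}"
  shows "\<bar>det (mat n n (\<lambda>(i, j). A $$ (\<pi> i, j)))\<bar> = \<bar>det A\<bar>"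
  using det_permute_rows[OF assms] by (simp add: abs_mult sign_def)

lemma abs_det_submatrix:
  fixes A :: "real mat"
  assumes f: "inj_on f {..<k}" "f ` {..<k} \<subseteq> {..<dim_row A}"
    and g: "inj_on g {..<k}" "g ` {..<k} \<subseteq> {..<dim_col A}"
  shows "\<bar>det (mat k k (\<lambda>(r, s). A $$ (f r, g s)))\<bar> = \<bar>det (submatrix A (f ` {..<k}) (g ` {..<k}))\<bar>"
proof -
  obtain \<pi> where \<pi>: "\<pi> permutes {0..<k}" "\<And>r. r < k \<Longrightarrow> f r = pick (f ` {..<k}) (\<pi> r)"
    using permutation_to_pick[OF f(1)] by blast
  obtain \<rho> where \<rho>: "\<rho> permutes {0..<k}" "\<And>r. r < k \<Longrightarrow> g r = pick (g ` {..<k}) (\<rho> r)"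
    using permutation_to_pick[OF g(1)] by blast
  let ?B = "mat k k (\<lambda>(r, s). A $$ (pick (f ` {..<k}) r, pick (g ` {..<k}) s))"
  \<comment> \<open>Columns are permuted as rows of the transpose, so the row lemma is used
    twice.\<close>
  let ?C = "mat k k (\<lambda>(r, s). transpose_mat ?B $$ (\<rho> r, s))"
  have \<pi>k: "\<pi> r < k" if "r < k" for r using permutes_in_image[OF \<pi>(1), of r] that by simp
  have \<rho>k: "\<rho> r < k" if "r < k" for r using permutes_in_image[OF \<rho>(1), of r] that by simp
  have "{i. i < dim_row A \<and> i \<in> f ` {..<k}} = f ` {..<k}" "{i. i < dim_col A \<and> i \<in> g ` {..<k}} = g ` {..<k}"
    using f g by auto
  then have "submatrix A (f ` {..<k}) (g ` {..<k}) = ?B"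
    using f g by (simp add: submatrix_def card_image)
  moreover have "mat k k (\<lambda>(r, s). A $$ (f r, g s)) = mat k k (\<lambda>(r, s). transpose_mat ?C $$ (\<pi> r, s))"
    using \<pi> \<rho> \<pi>k \<rho>k by (intro eq_matI) auto
  moreover have "\<bar>det \<dots>\<bar> = \<bar>det (transpose_mat ?C)\<bar>"
    by (rule abs_det_permute_rows[OF _ \<pi>(1)]) simp
  moreover have "\<dots> = \<bar>det ?C\<bar>"
    by (subst det_transpose[of _ k]) auto
  moreover have "\<dots> = \<bar>det (transpose_mat ?B)\<bar>"
    by (rule abs_det_permute_rows[OF _ \<rho>(1)]) simp
  moreover have "\<dots> = \<bar>det ?B\<bar>"
    by (subst det_transpose[of _ k]) auto
  ultimately show ?thesis by simp
qed

lemma abs_minor_le_detlb: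
  assumes k: "1 \<le> k" and f: "inj_on f {..<k}" "f ` {..<k} \<subseteq> {..<dim_row A}"
    and g: "inj_on g {..<k}" "g ` {..<k} \<subseteq> {..<dim_col A}"
  shows "\<bar>det (mat k k (\<lambda>(r, s). A $$ (f r, g s)))\<bar> \<le> detlb A ^ k"
proof -
  let ?d = "\<bar>det (submatrix A (f ` {..<k}) (g ` {..<k}))\<bar>"
  let ?S = "{root k \<bar>det (submatrix A I J)\<bar> |k I J.
     1 \<le> k \<and> I \<subseteq> {..<dim_row A} \<and> J \<subseteq> {..<dim_col A} \<and> card I = k \<and> card J = k}"
  \<comment> \<open>The order \<open>k\<close> is determined by \<open>I\<close>, so finitely many
    pairs of index sets account for all values and \<open>Max\<close> is meaningful.\<close>
  have "?S \<subseteq> (\<lambda>(I, J). root (card I) \<bar>det (submatrix A I J)\<bar>) ` (Pow {..<dim_row A} \<times> Pow {..<dim_col A})"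
    by auto
  then have "finite ?S" by (rule finite_subset) auto
  moreover have "root k ?d \<in> ?S"
    using k f(2) g(2) card_image[OF f(1)] card_image[OF g(1)]
    by (intro CollectI exI[of _ k] exI[of _ "f ` {..<k}"] exI[of _ "g ` {..<k}"]) simp
  ultimately have "root k ?d \<le> detlb A"
    unfolding detlb_def by (rule Max_ge)
  then have "root k ?d ^ k \<le> detlb A ^ k"
    by (intro power_mono real_root_ge_zero) auto
  then show ?thesis
    using k abs_det_submatrix[OF f g] by simp
qed

lemma detlb_nonneg:
  assumes "0 < dim_row A" "0 < dim_col A"
  shows "0 \<le> detlb A"
proof -
  have "\<bar>det (mat 1 1 (\<lambda>(r, s). A $$ (0, 0)))\<bar> \<le> detlb A ^ 1"
    using assms by (intro abs_minor_le_detlb[of 1 "\<lambda>_. 0" A "\<lambda>_. 0"]) (auto simp: inj_on_def)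
  with abs_ge_zero have "0 \<le> detlb A ^ 1" by (rule order_trans)
  then show ?thesis by simp
qed

section \<open>From colorings to hereditary discrepancy\<close>

lemma disc_le:
  assumes "finite V" "finite S" "S \<noteq> {}" "\<chi> \<in> V \<rightarrow>\<^sub>E {-1, 1}" "\<And>F. F \<in> S \<Longrightarrow> \<bar>\<Sum>j\<in>F. \<chi> j\<bar> \<le> D"
  shows "disc V S \<le> D"
proof -
  have "disc V S \<le> (MAX F \<in> S. \<bar>\<Sum>j\<in>F. \<chi> j\<bar>)"
    unfolding disc_def using assms by (intro Min_le finite_imageI finite_PiE) auto
  also have "\<dots> \<le> D"
    using assms by (subst Max_le_iff) auto
  finally show ?thesis .
qed

lemma herdisc_le:
  assumes "finite V" "\<And>J. J \<subseteq> V \<Longrightarrow> disc J (restrict_system S J) \<le> D"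
  shows "herdisc V S \<le> D"
  unfolding herdisc_def using assms by (subst Max_le_iff) auto

text \<open>Since 4 \<le> y^2, the constant is absorbed into a cube.\<close>

lemma ln_four_mult_le:
  assumes "2 \<le> (y::real)"
  shows "ln (4 * y) \<le> 3 * ln y"
proof -
  have "4 * y \<le> y\<^sup>2 * y"
    using power_mono[OF assms, of 2] assms by (intro mult_right_mono) auto
  then have "ln (4 * y) \<le> ln (y ^ 3)"
    using assms by (subst ln_le_cancel_iff) (auto simp: power2_eq_square power3_eq_cube)
  then show ?thesis using assms by (simp add: ln_realpow)
qed

text \<open>The rounding argument is run on each restriction \<open>J\<close>. The constant 12 is
  the 4 of the coloring bound times the 3 from \<open>ln_four_mult_le\<close>.\<close>

lemma herdisc_le_ln_mult_detlb:
  assumes "n \<ge> 2" "m \<ge> 1"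
  shows "herdisc {1..n} (F ` {1..m}) \<le> 12 * ln (real (m * n)) * detlb (incidence_mat m n F)"
proof -
  let ?M = "incidence_mat m n F"
  have mn: "2 \<le> m * n" using mult_le_mono[OF assms(2,1)] by simp
  then have mn': "2 \<le> real (m * n)" by linarith
  have ln_pos: "0 < 12 * ln (real (m * n))" using mn' by simp
  \<comment> \<open>The rounding argument divides by its scale, so it is run with a strictly larger,
    hence positive, \<open>L\<close>; this includes the case that \<open>detlb\<close> is 0.\<close>
  have bound: "herdisc {1..n} (F ` {1..m}) \<le> 12 * ln (real (m * n)) * L" if L: "detlb ?M < L" for L
  proof (rule herdisc_le)
    fix J assume J: "J \<subseteq> {1..n}"
    have finJ: "finite J" using J finite_subset by blast
    define a :: "nat \<Rightarrow> nat \<Rightarrow> real" where "a i j = (if j \<in> F i then 1 else 0)" for i j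
    have minor: "\<bar>det (mat k k (\<lambda>(r, s). a (f r) (g s)))\<bar> \<le> detlb ?M ^ k"
      if fg: "1 \<le> k" "inj_on f {..<k}" "inj_on g {..<k}" "f ` {..<k} \<subseteq> {1..m}" "g ` {..<k} \<subseteq> {1..n}" for k f g
    proof -
      have f1: "1 \<le> f r" "f r \<le> m" and g1: "1 \<le> g r" "g r \<le> n" if "r < k" for r
        using fg that by auto
      \<comment> \<open>Sets and points are numbered from 1, matrix indices from 0.\<close>
      have shifted: "f r - 1 < m" "Suc (f r - 1) = f r" "g r - 1 < n" "Suc (g r - 1) = g r" if "r < k" for r
        using f1[OF that] g1[OF that] by linarith+
      have eq: "mat k k (\<lambda>(r, s). a (f r) (g s)) = mat k k (\<lambda>(r, s). ?M $$ (f r - 1, g s - 1))"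
        using shifted by (intro eq_matI) (auto simp: incidence_mat_def a_def)
      have "inj_on (\<lambda>r. h r - 1) {..<k}" if h: "inj_on h {..<k}" "\<And>r. r < k \<Longrightarrow> 1 \<le> h r" for h :: "nat \<Rightarrow> nat"
      proof (rule inj_onI)
        fix r s assume rs: "r \<in> {..<k}" "s \<in> {..<k}" "h r - 1 = h s - 1"
        then have "h r = h s" using h(2)[of r] h(2)[of s] by simp
        then show "r = s" using inj_onD[OF h(1)] rs by blast
      qed
      from this[of f] this[of g]
      have "inj_on (\<lambda>r. f r - 1) {..<k}" "inj_on (\<lambda>r. g r - 1) {..<k}"
        using fg(2,3) f1(1) g1(1) by blast+
      moreover have "(\<lambda>r. f r - 1) ` {..<k} \<subseteq> {..<dim_row ?M}" "(\<lambda>r. g r - 1) ` {..<k} \<subseteq> {..<dim_col ?M}"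
        using shifted by (auto simp: incidence_mat_def)
      ultimately show ?thesis
        unfolding eq using fg(1) by (intro abs_minor_le_detlb)
    qed
    have "0 \<le> detlb ?M"
      using assms(1,2) by (intro detlb_nonneg) (auto simp: incidence_mat_def)
    interpret bounded_minors "{1..m}" J a L
    proof
      fix k and f g :: "nat \<Rightarrow> nat"
      assume "1 \<le> k" "inj_on f {..<k}" "inj_on g {..<k}" "f ` {..<k} \<subseteq> {1..m}" "g ` {..<k} \<subseteq> J"
      then have "\<bar>det (mat k k (\<lambda>(r, s). a (f r) (g s)))\<bar> \<le> detlb ?M ^ k"
        using J by (intro minor) auto
      also have "\<dots> \<le> L ^ k"
        using L \<open>0 \<le> detlb ?M\<close> by (intro power_mono) auto
      finally show "\<bar>det (mat k k (\<lambda>(r, s). a (f r) (g s)))\<bar> \<le> L ^ k" .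
    qed (use assms finJ L \<open>0 \<le> detlb ?M\<close> in auto)
    obtain \<chi> where \<chi>: "\<chi> \<in> J \<rightarrow>\<^sub>E {-1, 1}"
      "\<And>i. i \<in> {1..m} \<Longrightarrow> \<bar>\<Sum>j\<in>J. a i j * \<chi> j\<bar> \<le> 4 * L * ln (4 * max 1 (card J) * m)"
      using exists_low_discrepancy_coloring by auto
    have "card J \<le> n" using card_mono[OF _ J] by simp
    then have "real (max 1 (card J) * m) \<le> real (m * n)"
      using assms(1) by (subst mult.commute) (intro of_nat_mono mult_le_mono; simp)
    moreover have "0 < real (max 1 (card J) * m)" using assms(2) by simp
    ultimately have "ln (4 * real (max 1 (card J) * m)) \<le> ln (4 * real (m * n))"
      by (subst ln_le_cancel_iff) linarith+
    also have "\<dots> \<le> 3 * ln (real (m * n))" by (rule ln_four_mult_le[OF mn'])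
    finally have ln_le: "4 * L * ln (4 * real (max 1 (card J) * m)) \<le> 4 * L * (3 * ln (real (m * n)))"
      using L_pos by (intro mult_left_mono) auto
    show "disc J (restrict_system (F ` {1..m}) J) \<le> 12 * ln (real (m * n)) * L"
    proof (rule disc_le[OF finJ _ _ \<chi>(1)])
      have rs: "restrict_system (F ` {1..m}) J = (\<lambda>i. F i \<inter> J) ` {1..m}"
        by (auto simp: restrict_system_def)
      show "finite (restrict_system (F ` {1..m}) J)" "restrict_system (F ` {1..m}) J \<noteq> {}"
        unfolding rs using assms(2) by auto
      fix E assume "E \<in> restrict_system (F ` {1..m}) J"
      then obtain i where i: "i \<in> {1..m}" "E = F i \<inter> J" unfolding rs by auto
      have "(\<Sum>j\<in>J. a i j * \<chi> j) = (\<Sum>j\<in>E. \<chi> j)"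
        unfolding i(2) using finJ by (intro sum.mono_neutral_cong_right) (auto simp: a_def)
      then show "\<bar>\<Sum>j\<in>E. \<chi> j\<bar> \<le> 12 * ln (real (m * n)) * L"
        using \<chi>(2)[OF i(1)] ln_le by (simp add: mult.assoc algebra_simps)
    qed
  qed simp
  \<comment> \<open>Letting \<open>L\<close> decrease to \<open>detlb\<close> removes the strict
    inequality.\<close>
  have "herdisc {1..n} (F ` {1..m}) / (12 * ln (real (m * n))) \<le> detlb ?M"
  proof (rule dense_ge)
    show "herdisc {1..n} (F ` {1..m}) / (12 * ln (real (m * n))) \<le> L" if "detlb ?M < L" for L
      using bound[OF that] ln_pos by (simp add: pos_divide_le_eq mult.commute del: of_nat_mult)
  qed
  then show ?thesis using ln_pos by (simp add: pos_divide_le_eq mult.commute del: of_nat_mult)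
qed

theorem theorem2:
  shows "\<exists>C::real. C > 0 \<and>
    (\<forall>(n::nat) (m::nat) (F :: nat \<Rightarrow> nat set).
      n \<ge> 2 \<longrightarrow> m \<ge> 1 \<longrightarrow> (\<forall>i\<in>{1..m}. F i \<subseteq> {1..n}) \<longrightarrow>
      herdisc {1..n} (F ` {1..m})
        \<le> C * ln (real (m * n)) * sqrt (ln (real n)) * detlb (incidence_mat m n F))"
proof (intro exI[of _ "12 / sqrt (ln 2)"] conjI allI impI)
  fix n m :: nat and F :: "nat \<Rightarrow> nat set"
  assume *: "n \<ge> 2" "m \<ge> 1" "\<forall>i\<in>{1..m}. F i \<subseteq> {1..n}"
  let ?d = "detlb (incidence_mat m n F)"
  have "2 \<le> m * n" using mult_le_mono[OF *(2,1)] by simp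
  then have "0 \<le> ln (real (m * n))" by (intro ln_ge_zero) linarith
  moreover have "0 \<le> ?d"
    using *(1,2) by (intro detlb_nonneg) (auto simp: incidence_mat_def)
  \<comment> \<open>As n \<ge> 2, this ratio can be multiplied in; it accounts for the constant
    \<open>12 / sqrt (ln 2)\<close>.\<close>
  moreover have "1 \<le> sqrt (ln (real n)) / sqrt (ln 2)"
    using *(1) by simp
  ultimately have "12 * ln (real (m * n)) * ?d * 1
      \<le> 12 * ln (real (m * n)) * ?d * (sqrt (ln (real n)) / sqrt (ln 2))"
    by (intro mult_left_mono mult_nonneg_nonneg) auto
  with herdisc_le_ln_mult_detlb[OF *(1,2), of F]
  show "herdisc {1..n} (F ` {1..m}) \<le> 12 / sqrt (ln 2) * ln (real (m * n)) * sqrt (ln (real n)) * ?d"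
    by (simp add: mult_ac)
qed simp

end
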